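(* Let $q$ be a prime power, let $\mathbb{F}_q$ be the finite field with $q$ elements, and let $d\ge 1$ and $k\ge 2$ be integers with $0<\binom{k}{2}<d$. There is a sufficiently large constant $C>0$ such that the following holds. Let $E\subset \mathbb{F}_q^d$ satisfy $$|E|\ge C\,q^{d\frac{k-1}{k}+\frac{k-1}{2}+\frac{1}{k}},$$ and let $\lambda_k$ be the number of $k$-tuples $(x^1,\dots,x^k)\in E^k$ of mutually orthogonal vectors, i.e. with $x^i\cdot x^j=0$ for all $1\le i<j\le k$. Then $$\lambda_k=(1+o(1))\,|E|^k\,q^{-\binom{k}{2}},$$ where $o(1)$ denotes a quantity tending to $0$ as $q\to\infty$.
   Context: For $x,y\in\mathbb{F}_q^d$, $x\cdot y=\sum_{i=1}^d x_iy_i$ is the standard dot product.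
   Formalization: For k=2 no fixed C works (d=4, E={x: x·x∈T}, 0∈T, |T|=m gives ratio 1+1/m²), so there C may depend on the accuracy ε asked of the o(1); for k≥3 C is fixed first as stated. F_q is taken with elements labelled by natural numbers. *)

theory Defs
  imports Complex_Main "HOL-Library.FuncSet" "HOL-Algebra.Ring"
begin

text \<open>The space $R^d$: vectors are extensional functions on the index set $\{1,\dots,d\}$.\<close>

definition vec_space :: "('a, 'b) ring_scheme \<Rightarrow> nat \<Rightarrow> (nat \<Rightarrow> 'a) set" where
  "vec_space R d = {1..d} \<rightarrow>\<^sub>E carrier R"

definition dot :: "('a, 'b) ring_scheme \<Rightarrow> nat \<Rightarrow> (nat \<Rightarrow> 'a) \<Rightarrow> (nat \<Rightarrow> 'a) \<Rightarrow> 'a" where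
  "dot R d x y = (\<Oplus>\<^bsub>R\<^esub>i\<in>{1..d}. x i \<otimes>\<^bsub>R\<^esub> y i)"

text \<open>Tuples $(x^1,\dots,x^k)$ are ordered and may have repeated entries; only pairs of
  different positions are required to be orthogonal.\<close>

definition orth_tuples ::
  "('a, 'b) ring_scheme \<Rightarrow> nat \<Rightarrow> nat \<Rightarrow> (nat \<Rightarrow> 'a) set \<Rightarrow> (nat \<Rightarrow> nat \<Rightarrow> 'a) set" where
  "orth_tuples R d k E =
     {x \<in> {1..k} \<rightarrow>\<^sub>E E. \<forall>i j. 1 \<le> i \<and> i < j \<and> j \<le> k \<longrightarrow> dot R d (x i) (x j) = \<zero>\<^bsub>R\<^esub>}"

definition orth_count ::
  "('a, 'b) ring_scheme \<Rightarrow> nat \<Rightarrow> nat \<Rightarrow> (nat \<Rightarrow> 'a) set \<Rightarrow> nat" where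
  "orth_count R d k E = card (orth_tuples R d k E)"

definition size_exponent :: "nat \<Rightarrow> nat \<Rightarrow> real" where
  "size_exponent d k = real d * ((real k - 1) / real k) + (real k - 1) / 2 + 1 / real k"

text \<open>For all sufficiently large $q$, every field with $q$ elements and every large enough $E$
  (with constant $C$), the count equals $(1+\delta)|E|^k q^{-\binom k2}$ with $|\delta|\le\epsilon$.
  The threshold for $q$ is uniform in the field and in $E$. Letting the carrier be a set of natural
  numbers loses nothing, since every finite field is isomorphic to one of this kind, and it allows
  constants to be chosen before the field.

  With $C$ chosen before $\epsilon$ this says that the ratio of the two sides is $1+o(1)$ as
  $q\to\infty$. For $k=2$ no such $C$ exists in general, and $C$ has to depend on $\epsilon$: for
  $q$ odd and $d=4$, the set $E=\{x.\ x\cdot x\in T\}$ with $0\in T$ and $|T|=m$ has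
  $|E|\sim mq^3$ (the threshold being $Cq^3$), but its number of orthogonal pairs is
  $\sim(1+m^{-2})|E|^2/q$.\<close>

definition eventually_within :: "nat \<Rightarrow> nat \<Rightarrow> real \<Rightarrow> real \<Rightarrow> bool" where
  "eventually_within d k C \<epsilon> \<longleftrightarrow>
     (\<forall>\<^sub>F q in sequentially. \<forall>(R :: nat ring) E.
        field R \<and> finite (carrier R) \<and> card (carrier R) = q \<and>
        E \<subseteq> vec_space R d \<and> real (card E) \<ge> C * real q powr size_exponent d k \<longrightarrow>
        (\<exists>\<delta>. \<bar>\<delta>\<bar> \<le> \<epsilon> \<and>
             real (orth_count R d k E) =
               (1 + \<delta>) * real (card E) ^ k * real q powr (- real (k choose 2))))"

end

theory Submission
  imports Defs "HOL-Analysis.L2_Norm"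
begin

text \<open>Orthogonality in \<open>\<bbbF>\<^sub>q\<^sup>d\<close> is pseudorandom of density \<open>1 / q\<close>: the functions
  \<open>x \<mapsto> [x \<cdot> y = 0] - 1 / q\<close> are pairwise orthogonal for linearly independent \<open>y\<close>, so a second-moment
  computation and Cauchy--Schwarz give \<open>q^(d/2) sqrt (|A| |B|)\<close> as the error in the number of orthogonal
  pairs in \<open>A \<times> B\<close>. The orthogonality conditions among the \<open>k\<close> vectors are the edges of a complete
  graph. Deleting the edges of a graph one by one, and applying the pair bound to the two endpoints
  with all other vectors fixed, shows that each deletion changes the normalised count by
  \<open>O(q^(d/2+k-1) / |E|)\<close>. The required size of \<open>E\<close> makes this at most \<open>1 / C\<close> if \<open>k = 2\<close>, and
  \<open>o(1)\<close> if \<open>k \<ge> 3\<close>, except that for \<open>k = 3\<close>, \<open>d = 4\<close> the required size is \<open>C q\<^sup>d\<close>,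
  which is impossible for \<open>C > 1\<close>.\<close>

section \<open>Counting graph homomorphisms into a pseudorandom relation\<close>

text \<open>The conclusion of the expander mixing lemma, with density \<open>p\<close> and error
  constant \<open>c\<close>. Since \<open>A\<close> and \<open>B\<close> are arbitrary, it applies
  to the sets of admissible images that remain once other vertices are fixed.\<close>

definition mixing :: "('a \<Rightarrow> 'a \<Rightarrow> bool) \<Rightarrow> 'a set \<Rightarrow> real \<Rightarrow> real \<Rightarrow> bool" where
  "mixing r E p c \<longleftrightarrow>
     (\<forall>A B. A \<subseteq> E \<and> B \<subseteq> E \<longrightarrow>
        \<bar>real (card {(a, b) \<in> A \<times> B. r a b}) - p * real (card A) * real (card B)\<bar>
          \<le> c * sqrt (real (card A) * real (card B)))"

text \<open>Homomorphisms from the graph \<open>(V, F)\<close> to the relation \<open>r\<close> on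
  \<open>E\<close>; they need not be injective, in accordance with tuples that may repeat entries.
  Below, an edge is stored once, with its smaller endpoint first.\<close>

definition homs ::
  "('a \<Rightarrow> 'a \<Rightarrow> bool) \<Rightarrow> 'a set \<Rightarrow> nat set \<Rightarrow> (nat \<times> nat) set \<Rightarrow> (nat \<Rightarrow> 'a) set" where
  "homs r E V F = {x \<in> V \<rightarrow>\<^sub>E E. \<forall>(i, j) \<in> F. r (x i) (x j)}"

lemma card_filter_PiE_insert:
  assumes "i \<notin> I" "finite I" "finite S"
  shows "card {x \<in> insert i I \<rightarrow>\<^sub>E S. P x} = (\<Sum>x \<in> I \<rightarrow>\<^sub>E S. card {a \<in> S. P (x(i := a))})"
proof -
  have fin: "finite (insert i I \<rightarrow>\<^sub>E S)"
    using assms by (intro finite_PiE) auto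
  have "card {x \<in> insert i I \<rightarrow>\<^sub>E S. P x} = (\<Sum>x \<in> insert i I \<rightarrow>\<^sub>E S. of_bool (P x))"
    using fin by (simp add: of_bool_def sum.If_cases Int_def)
  also have "\<dots> = (\<Sum>(a, x) \<in> S \<times> (I \<rightarrow>\<^sub>E S). of_bool (P (x(i := a))))"
    unfolding PiE_insert_eq
    by (subst sum.reindex[OF inj_combinator[OF assms(1)]]) (auto intro!: sum.cong)
  also have "\<dots> = (\<Sum>x \<in> I \<rightarrow>\<^sub>E S. \<Sum>a\<in>S. of_bool (P (x(i := a))))"
    by (subst sum.cartesian_product[symmetric], rule sum.swap)
  also have "\<dots> = (\<Sum>x \<in> I \<rightarrow>\<^sub>E S. card {a \<in> S. P (x(i := a))})"
    using assms(3) by (intro sum.cong refl) (simp add: of_bool_def sum.If_cases Int_def)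
  finally show ?thesis .
qed

lemma card_filter_Times:
  assumes "finite S" "finite T"
  shows "card {(a, b) \<in> S \<times> T. P a b} = (\<Sum>b\<in>T. card {a\<in>S. P a b})"
proof -
  have "card {(a, b) \<in> S \<times> T. P a b} = card (SIGMA b:T. {a\<in>S. P a b})"
    by (rule bij_betw_same_card[of "\<lambda>(a, b). (b, a)"])
       (auto simp: bij_betw_def inj_on_def image_def)
  also have "\<dots> = (\<Sum>b\<in>T. card {a\<in>S. P a b})"
    using assms by (simp add: card_SigmaI)
  finally show ?thesis .
qed

text \<open>Cauchy--Schwarz for the vectors with entries \<open>sqrt (f x)\<close> and
  \<open>sqrt (g x)\<close>.\<close>

lemma sum_sqrt_mult_le:
  fixes f g :: "'a \<Rightarrow> real"
  assumes "\<And>x. x \<in> A \<Longrightarrow> 0 \<le> f x" "\<And>x. x \<in> A \<Longrightarrow> 0 \<le> g x"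
  shows "(\<Sum>x\<in>A. sqrt (f x * g x)) \<le> sqrt (sum f A * sum g A)"
proof -
  have "(\<Sum>x\<in>A. sqrt (f x * g x)) = (\<Sum>x\<in>A. \<bar>sqrt (f x)\<bar> * \<bar>sqrt (g x)\<bar>)"
    using assms by (intro sum.cong refl) (simp add: real_sqrt_mult)
  also have "\<dots> \<le> L2_set (\<lambda>x. sqrt (f x)) A * L2_set (\<lambda>x. sqrt (g x)) A"
    by (rule L2_set_mult_ineq)
  also have "\<dots> = sqrt (sum f A * sum g A)"
    using assms by (simp add: L2_set_def real_sqrt_mult cong: sum.cong)
  finally show ?thesis .
qed

text \<open>Fix the images \<open>x\<close> of all vertices except \<open>i\<close> and
  \<open>j\<close>. Without the edge \<open>(i, j)\<close>, the admissible pairs of images of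
  \<open>i\<close> and \<open>j\<close> form a product \<open>A x \<times> B x\<close>, and mixing
  says which proportion of it the edge keeps. The errors are summed over \<open>x\<close> by
  Cauchy--Schwarz; the sizes of \<open>A x\<close> and of \<open>B x\<close> add up to the counts
  for the graph with \<open>j\<close>, respectively \<open>i\<close>, deleted.\<close>

lemma card_homs_remove_edge:
  assumes mix: "mixing r E p c" and "0 \<le> c" and finE: "finite E" and finV: "finite V"
    and F: "F \<subseteq> {(u, v). u \<in> V \<and> v \<in> V \<and> u < v}" and ij: "(i, j) \<in> F"
  shows "\<bar>real (card (homs r E V F)) - p * real (card (homs r E V (F - {(i, j)})))\<bar>
    \<le> c * sqrt (real (card (homs r E (V - {j}) {(u, v) \<in> F. u \<noteq> j \<and> v \<noteq> j})) *
                real (card (homs r E (V - {i}) {(u, v) \<in> F. u \<noteq> i \<and> v \<noteq> i})))"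
proof -
  define W where "W = V - {i, j}"
  define A where "A x = {a \<in> E. x(i := a) \<in> homs r E (V - {j}) {(u, v) \<in> F. u \<noteq> j \<and> v \<noteq> j}}" for x
  define B where "B x = {b \<in> E. x(j := b) \<in> homs r E (V - {i}) {(u, v) \<in> F. u \<noteq> i \<and> v \<noteq> i}}" for x
  define X where "X = (W \<rightarrow>\<^sub>E E)"
  have ij': "i \<in> V" "j \<in> V" "i < j"
    using F ij by auto
  have W: "finite W" "i \<notin> W" "j \<notin> W" "i \<notin> insert j W"
    and Vi: "V - {j} = insert i W" and Vj: "V - {i} = insert j W"
    and V: "V = insert i (insert j W)"
    using ij' finV by (auto simp: W_def)
  have AB: "A x \<subseteq> E" "B x \<subseteq> E" "finite (A x)" "finite (B x)" for x
    using finE by (auto simp: A_def B_def)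
  have cA: "card (homs r E (V - {j}) {(u, v) \<in> F. u \<noteq> j \<and> v \<noteq> j}) = (\<Sum>x\<in>X. card (A x))"
  proof -
    have "card (homs r E (V - {j}) {(u, v) \<in> F. u \<noteq> j \<and> v \<noteq> j}) =
        card {x \<in> insert i W \<rightarrow>\<^sub>E E. x \<in> homs r E (V - {j}) {(u, v) \<in> F. u \<noteq> j \<and> v \<noteq> j}}"
      unfolding homs_def Vi by (rule arg_cong[where f = card]) auto
    also have "\<dots> = (\<Sum>x\<in>X. card (A x))"
      unfolding X_def A_def using W finE by (subst card_filter_PiE_insert) auto
    finally show ?thesis .
  qed
  have cB: "card (homs r E (V - {i}) {(u, v) \<in> F. u \<noteq> i \<and> v \<noteq> i}) = (\<Sum>x\<in>X. card (B x))"
  proof -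
    have "card (homs r E (V - {i}) {(u, v) \<in> F. u \<noteq> i \<and> v \<noteq> i}) =
        card {x \<in> insert j W \<rightarrow>\<^sub>E E. x \<in> homs r E (V - {i}) {(u, v) \<in> F. u \<noteq> i \<and> v \<noteq> i}}"
      unfolding homs_def Vj by (rule arg_cong[where f = card]) auto
    also have "\<dots> = (\<Sum>x\<in>X. card (B x))"
      unfolding X_def B_def using W finE by (subst card_filter_PiE_insert) auto
    finally show ?thesis .
  qed
  have split: "card {x \<in> V \<rightarrow>\<^sub>E E. P x} =
      (\<Sum>x\<in>X. card {(a, b) \<in> E \<times> E. P (x(j := b, i := a))})" for P
  proof -
    have "card {x \<in> V \<rightarrow>\<^sub>E E. P x} =
        (\<Sum>y \<in> insert j W \<rightarrow>\<^sub>E E. card {a \<in> E. P (y(i := a))})"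
      unfolding V using W finE by (subst card_filter_PiE_insert) auto
    also have "\<dots> = (\<Sum>x\<in>X. \<Sum>b\<in>E. card {a \<in> E. P (x(j := b, i := a))})"
      unfolding X_def PiE_insert_eq
      by (subst sum.reindex[OF inj_combinator[OF W(3)]])
         (simp add: case_prod_unfold sum.cartesian_product', rule sum.swap)
    also have "\<dots> = (\<Sum>x\<in>X. card {(a, b) \<in> E \<times> E. P (x(j := b, i := a))})"
      by (intro sum.cong refl card_filter_Times[symmetric] finE)
    finally show ?thesis .
  qed
  \<comment> \<open>an edge other than \<open>(i, j)\<close> misses \<open>i\<close> or \<open>j\<close>, so its constraint is seen by \<open>A\<close> or by \<open>B\<close>\<close>
  have hom_iff: "(\<forall>(u, v) \<in> F - {(i, j)}. r ((x(j := b, i := a)) u) ((x(j := b, i := a)) v))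
      \<longleftrightarrow> a \<in> A x \<and> b \<in> B x" if "x \<in> X" "a \<in> E" "b \<in> E" for x a b
  proof -
    have mem: "x(i := a) \<in> insert i W \<rightarrow>\<^sub>E E" "x(j := b) \<in> insert j W \<rightarrow>\<^sub>E E"
      using that by (auto simp: X_def intro!: PiE_fun_upd)
    define y where "y = x(j := b, i := a)"
    have "r ((x(i := a)) u) ((x(i := a)) v) \<longleftrightarrow> r (y u) (y v)" if "u \<noteq> j" "v \<noteq> j" for u v
      using that by (simp add: y_def)
    moreover have "a \<in> A x \<longleftrightarrow> (\<forall>(u, v) \<in> F. u \<noteq> j \<and> v \<noteq> j \<longrightarrow> r ((x(i := a)) u) ((x(i := a)) v))"
      using that mem unfolding A_def homs_def Vi by blast
    ultimately have 1: "a \<in> A x \<longleftrightarrow> (\<forall>u v. (u, v) \<in> F \<longrightarrow> u \<noteq> j \<longrightarrow> v \<noteq> j \<longrightarrow> r (y u) (y v))"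
      by blast
    have "r ((x(j := b)) u) ((x(j := b)) v) \<longleftrightarrow> r (y u) (y v)" if "u \<noteq> i" "v \<noteq> i" for u v
      using that by (simp add: y_def)
    moreover have "b \<in> B x \<longleftrightarrow> (\<forall>(u, v) \<in> F. u \<noteq> i \<and> v \<noteq> i \<longrightarrow> r ((x(j := b)) u) ((x(j := b)) v))"
      using that mem unfolding B_def homs_def Vj by blast
    ultimately have 2: "b \<in> B x \<longleftrightarrow> (\<forall>u v. (u, v) \<in> F \<longrightarrow> u \<noteq> i \<longrightarrow> v \<noteq> i \<longrightarrow> r (y u) (y v))"
      by blast
    have "(u \<noteq> j \<and> v \<noteq> j) \<or> (u \<noteq> i \<and> v \<noteq> i)" if "(u, v) \<in> F - {(i, j)}" for u v
      using that F ij' by auto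
    then show ?thesis
      unfolding 1 2 y_def[symmetric] by blast
  qed
  have hom_iff': "(\<forall>(u, v) \<in> F. r ((x(j := b, i := a)) u) ((x(j := b, i := a)) v))
      \<longleftrightarrow> a \<in> A x \<and> b \<in> B x \<and> r a b" if "x \<in> X" "a \<in> E" "b \<in> E" for x a b
  proof -
    have "(\<forall>(u, v) \<in> F. Q u v) \<longleftrightarrow> (\<forall>(u, v) \<in> F - {(i, j)}. Q u v) \<and> Q i j" for Q
      using ij by auto
    from this[of "\<lambda>u v. r ((x(j := b, i := a)) u) ((x(j := b, i := a)) v)"] hom_iff[OF that]
    show ?thesis using ij' by auto
  qed
  have N: "card (homs r E V F) = (\<Sum>x\<in>X. card {(a, b) \<in> A x \<times> B x. r a b})"
    unfolding homs_def split
    using AB hom_iff' by (intro sum.cong refl arg_cong[where f = card]) blast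
  have N': "card (homs r E V (F - {(i, j)})) = (\<Sum>x\<in>X. card (A x) * card (B x))"
  proof -
    have "card (homs r E V (F - {(i, j)})) = (\<Sum>x\<in>X. card (A x \<times> B x))"
      unfolding homs_def split
      using AB hom_iff by (intro sum.cong refl arg_cong[where f = card]) blast
    then show ?thesis by (simp add: card_cartesian_product)
  qed
  have "\<bar>real (card (homs r E V F)) - p * real (card (homs r E V (F - {(i, j)})))\<bar> =
      \<bar>\<Sum>x\<in>X. real (card {(a, b) \<in> A x \<times> B x. r a b}) - p * real (card (A x)) * real (card (B x))\<bar>"
    unfolding N N' by (simp add: sum_subtractf sum_distrib_left mult.assoc)
  also have "\<dots> \<le> (\<Sum>x\<in>X. c * sqrt (real (card (A x)) * real (card (B x))))"
    using mix AB unfolding mixing_def by (intro order_trans[OF sum_abs] sum_mono) blast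
  also have "\<dots> \<le> c * sqrt ((\<Sum>x\<in>X. real (card (A x))) * (\<Sum>x\<in>X. real (card (B x))))"
    unfolding sum_distrib_left[symmetric]
    using \<open>0 \<le> c\<close> by (intro mult_left_mono sum_sqrt_mult_le) auto
  finally show ?thesis
    unfolding cA cB by simp
qed

text \<open>An edge at \<open>j\<close> is determined by its other endpoint, because pairs are
  increasing. So deleting a vertex loses at most \<open>card V - 1\<close> factors \<open>p\<close>
  of the expected count.\<close>

lemma card_edges_at_le:
  fixes F :: "(nat \<times> nat) set"
  assumes "finite V" "F \<subseteq> {(u, v). u \<in> V \<and> v \<in> V \<and> u < v}" "j \<in> V"
  shows "card F \<le> card {(u, v) \<in> F. u \<noteq> j \<and> v \<noteq> j} + (card V - 1)"
proof -
  let ?S = "{(u, v) \<in> F. u \<noteq> j \<and> v \<noteq> j}" and ?T = "{(u, v) \<in> F. u = j \<or> v = j}"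
  have "finite F"
    using assms(1,2) by (rule_tac finite_subset[of F "V \<times> V"]) auto
  have lt: "u < v" if "(u, v) \<in> F" for u v
    using assms(2) that by auto
  have irrefl: "(u, u) \<notin> F" and asym: "(u, v) \<in> F \<Longrightarrow> (v, u) \<notin> F" for u v
    using lt[of u u] lt[of u v] lt[of v u] by auto
  have "card F = card (?S \<union> ?T)"
    by (rule arg_cong[where f = card]) auto
  also have "\<dots> \<le> card ?S + card ?T"
    by (rule card_Un_le)
  also have "card ?T \<le> card (V - {j})"
    using assms by (intro card_inj_on_le[of "\<lambda>(u, v). if u = j then v else u"])
      (auto simp: inj_on_def irrefl dest: asym split: if_splits)
  finally show ?thesis
    using assms by simp
qed

text \<open>Induction on the number of edges, with \<open>V\<close> varying because vertices are
  deleted too. Each edge contributes a relative error \<open>2 * \<eta>\<close>: the bound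
  \<open>2 * card F * \<eta> \<le> 1\<close> keeps the counts for vertex-deleted graphs below twice
  the expected value, which is the source of the 2, and the factor \<open>p ^ (k - 1)\<close> in the
  bound on \<open>c\<close> pays for the edges lost with the vertex.\<close>

lemma card_homs_approx:
  assumes mix: "mixing r E p c" and "0 \<le> c" and finE: "finite E" and p: "0 < p" "p \<le> 1"
    and c: "c \<le> \<eta> * real (card E) * p ^ (k - 1)"
  assumes "finite V" "card V \<le> k" "F \<subseteq> {(u, v). u \<in> V \<and> v \<in> V \<and> u < v}"
    "0 \<le> \<eta>" "2 * real (card F) * \<eta> \<le> 1"
  shows "\<bar>real (card (homs r E V F)) - p ^ card F * real (card E) ^ card V\<bar>
    \<le> 2 * real (card F) * \<eta> * (p ^ card F * real (card E) ^ card V)"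
  using assms(7-)
proof (induction "card F" arbitrary: F V rule: less_induct)
  case less
  let ?n = "real (card E)"
  have finF: "finite F"
    using less.prems by (rule_tac finite_subset[of F "V \<times> V"]) auto
  show ?case
  proof (cases "F = {}")
    case True
    then have "homs r E V F = (V \<rightarrow>\<^sub>E E)"
      by (auto simp: homs_def)
    then show ?thesis
      using True less.prems by (simp add: card_PiE)
  next
    case False
    then obtain i j where ij: "(i, j) \<in> F" by auto
    then have ij': "i \<in> V" "j \<in> V" "i < j"
      using less.prems by auto
    have cV: "card V = Suc (card V - 1)"
      using ij' less.prems(1) by (metis Suc_pred' card_gt_0_iff empty_iff)
    have pow_card: "?n ^ card V = ?n * ?n ^ (card V - 1)"
      by (metis cV power_Suc)
    have cF: "card F = Suc (card (F - {(i, j)}))"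
      using finF ij by (metis card.remove)
    have small: "2 * real m * \<eta> \<le> 1" if "m \<le> card F" for m
      using less.prems(4,5) that
      by (meson mult_left_mono mult_right_mono of_nat_mono order_trans zero_le_numeral)
    \<comment> \<open>The induction hypothesis has relative error at most 1 here, hence the factor
      2; \<open>p ^ (k - 1)\<close> makes up for the at most \<open>k - 1\<close> edges at
      \<open>l\<close>.\<close>
    have sub: "real (card (homs r E (V - {l}) {(u, v) \<in> F. u \<noteq> l \<and> v \<noteq> l}))
        * p ^ (k - 1) \<le> 2 * (p ^ card F * ?n ^ (card V - 1))"
      if l: "l \<in> V" "l = i \<or> l = j" for l
    proof -
      let ?G = "{(u, v) \<in> F. u \<noteq> l \<and> v \<noteq> l}"
      have "?G \<subset> F" using ij l by auto
      then have less_card: "card ?G < card F" using finF by (rule psubset_card_mono[rotated])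
      have cVl: "card (V - {l}) = card V - 1" using l less.prems(1) by simp
      have "\<bar>real (card (homs r E (V - {l}) ?G)) - p ^ card ?G * ?n ^ card (V - {l})\<bar>
          \<le> 2 * real (card ?G) * \<eta> * (p ^ card ?G * ?n ^ card (V - {l}))"
        using less.prems less_card small[of "card ?G"] cVl
        by (intro less.hyps) auto
      also have "\<dots> \<le> 1 * (p ^ card ?G * ?n ^ card (V - {l}))"
        using p less_card by (intro mult_right_mono small) auto
      finally have "real (card (homs r E (V - {l}) ?G)) \<le> 2 * (p ^ card ?G * ?n ^ (card V - 1))"
        unfolding cVl by linarith
      then have "real (card (homs r E (V - {l}) ?G)) * p ^ (k - 1) \<le>
          2 * (p ^ card ?G * ?n ^ (card V - 1)) * p ^ (k - 1)"
        using p by (intro mult_right_mono) auto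
      also have "\<dots> = 2 * (p ^ (card ?G + (k - 1)) * ?n ^ (card V - 1))"
        by (simp add: power_add)
      also have "\<dots> \<le> 2 * (p ^ card F * ?n ^ (card V - 1))"
      proof -
        have "card F \<le> card ?G + (k - 1)"
          using card_edges_at_le[OF less.prems(1,3) l(1)] less.prems(2) by linarith
        then show ?thesis
          using p by (intro mult_left_mono mult_right_mono power_decreasing) auto
      qed
      finally show ?thesis .
    qed
    define a where "a = real (card (homs r E (V - {j}) {(u, v) \<in> F. u \<noteq> j \<and> v \<noteq> j}))"
    define b where "b = real (card (homs r E (V - {i}) {(u, v) \<in> F. u \<noteq> i \<and> v \<noteq> i}))"
    define M where "M = 2 * (p ^ card F * ?n ^ (card V - 1))"
    have ab: "0 \<le> a" "0 \<le> b" "a * p ^ (k - 1) \<le> M" "b * p ^ (k - 1) \<le> M"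
      using sub ij' by (auto simp: a_def b_def M_def)
    have M0: "0 \<le> M" using p by (simp add: M_def)
    have sq: "sqrt (a * b) * p ^ (k - 1) \<le> M"
    proof -
      have "sqrt (a * b) * p ^ (k - 1) = sqrt ((a * p ^ (k - 1)) * (b * p ^ (k - 1)))"
        using p by (simp add: real_sqrt_mult)
      also have "\<dots> \<le> sqrt (M * M)"
        using ab p M0 by (intro real_sqrt_le_mono mult_mono) auto
      finally show ?thesis using M0 by simp
    qed
    have "\<bar>real (card (homs r E V F)) - p * real (card (homs r E V (F - {(i, j)})))\<bar> \<le> c * sqrt (a * b)"
      unfolding a_def b_def
      by (rule card_homs_remove_edge[OF mix \<open>0 \<le> c\<close> finE less.prems(1,3) ij])
    also have "\<dots> \<le> (\<eta> * ?n * p ^ (k - 1)) * sqrt (a * b)"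
      using c ab by (intro mult_right_mono) auto
    also have "\<dots> = \<eta> * ?n * (sqrt (a * b) * p ^ (k - 1))"
      by simp
    also have "\<dots> \<le> \<eta> * ?n * M"
      using sq less.prems(4) by (intro mult_left_mono) auto
    also have "\<dots> = 2 * \<eta> * (p ^ card F * ?n ^ card V)"
      by (simp add: M_def pow_card)
    finally have 1: "\<bar>real (card (homs r E V F)) - p * real (card (homs r E V (F - {(i, j)})))\<bar>
      \<le> 2 * \<eta> * (p ^ card F * ?n ^ card V)" .
    \<comment> \<open>The other edges are left to the induction hypothesis on the same vertices.
      Multiplying by \<open>p\<close> restores the expected count for \<open>F\<close>, and the
      error constants of the two estimates add up.\<close>
    let ?m = "card (F - {(i, j)})"
    have "\<bar>real (card (homs r E V (F - {(i, j)}))) - p ^ ?m * ?n ^ card V\<bar>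
      \<le> 2 * real ?m * \<eta> * (p ^ ?m * ?n ^ card V)"
      using less.prems cF small[of ?m] by (intro less.hyps) auto
    then have "p * \<bar>real (card (homs r E V (F - {(i, j)}))) - p ^ ?m * ?n ^ card V\<bar>
      \<le> p * (2 * real ?m * \<eta> * (p ^ ?m * ?n ^ card V))"
      using p by (intro mult_left_mono) auto
    moreover have "p * real (card (homs r E V (F - {(i, j)}))) - p ^ card F * ?n ^ card V =
      p * (real (card (homs r E V (F - {(i, j)}))) - p ^ ?m * ?n ^ card V)"
      unfolding cF by (simp add: algebra_simps)
    ultimately have 2: "\<bar>p * real (card (homs r E V (F - {(i, j)}))) - p ^ card F * ?n ^ card V\<bar>
      \<le> 2 * real ?m * \<eta> * (p ^ card F * ?n ^ card V)"
      using p unfolding cF by (simp add: abs_mult ac_simps)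
    have "2 * real (card F) * \<eta> * (p ^ card F * ?n ^ card V) =
      2 * \<eta> * (p ^ card F * ?n ^ card V) + 2 * real ?m * \<eta> * (p ^ card F * ?n ^ card V)"
      by (subst cF) (simp add: algebra_simps)
    with 1 2 show ?thesis by linarith
  qed
qed

section \<open>Dot products and point counts of hyperplanes over a finite field\<close>

context field
begin

abbreviation nonzero_vec :: "nat \<Rightarrow> (nat \<Rightarrow> 'a) \<Rightarrow> bool" where
  "nonzero_vec d y \<equiv> (\<exists>j \<in> {1..d}. y j \<noteq> \<zero>)"

lemma vec_space_closed: "x \<in> vec_space R d \<Longrightarrow> i \<in> {1..d} \<Longrightarrow> x i \<in> carrier R"
  by (auto simp: vec_space_def)

lemma dot_closed: "x \<in> vec_space R d \<Longrightarrow> y \<in> vec_space R d \<Longrightarrow> dot R d x y \<in> carrier R"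
  unfolding dot_def by (intro finsum_closed) (auto simp: vec_space_closed)

lemma dot_zero_right:
  assumes "x \<in> vec_space R d" "y \<in> vec_space R d" "\<not> nonzero_vec d y"
  shows "dot R d x y = \<zero>"
proof -
  have "dot R d x y = (\<Oplus>i\<in>{1..d}. \<zero>)"
    unfolding dot_def using assms by (intro finsum_cong') (auto simp: vec_space_closed)
  then show ?thesis by simp
qed

text \<open>Linear dependence of \<open>z\<close> on \<open>y\<close> is expressed below as the
  vanishing of this vector for some \<open>c\<close>. The restriction to \<open>{1..d}\<close> keeps
  it extensional.\<close>

definition axpy :: "nat \<Rightarrow> 'a \<Rightarrow> (nat \<Rightarrow> 'a) \<Rightarrow> (nat \<Rightarrow> 'a) \<Rightarrow> (nat \<Rightarrow> 'a)" where
  "axpy d c y z = (\<lambda>i\<in>{1..d}. c \<otimes> y i \<oplus> z i)"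

lemma axpy_closed:
  "c \<in> carrier R \<Longrightarrow> y \<in> vec_space R d \<Longrightarrow> z \<in> vec_space R d \<Longrightarrow> axpy d c y z \<in> vec_space R d"
  by (auto simp: axpy_def vec_space_def)

lemma dot_axpy:
  assumes "c \<in> carrier R" "x \<in> vec_space R d" "y \<in> vec_space R d" "z \<in> vec_space R d"
  shows "dot R d x (axpy d c y z) = c \<otimes> dot R d x y \<oplus> dot R d x z"
proof -
  note [simp] = vec_space_closed[OF assms(2)] vec_space_closed[OF assms(3)]
    vec_space_closed[OF assms(4)]
  have "dot R d x (axpy d c y z) = (\<Oplus>i\<in>{1..d}. c \<otimes> (x i \<otimes> y i) \<oplus> x i \<otimes> z i)"
    unfolding dot_def using assms(1)
    by (intro finsum_cong') (auto simp: axpy_def r_distr m_lcomm)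
  also have "\<dots> = (\<Oplus>i\<in>{1..d}. c \<otimes> (x i \<otimes> y i)) \<oplus> dot R d x z"
    unfolding dot_def using assms(1) by (intro finsum_addf) auto
  also have "\<dots> = c \<otimes> dot R d x y \<oplus> dot R d x z"
    unfolding dot_def using assms(1) by (subst finsum_rdistr) auto
  finally show ?thesis .
qed

lemma card_affine_roots:
  assumes "a \<in> carrier R" "b \<in> carrier R" "a \<noteq> \<zero>"
  shows "card {c \<in> carrier R. c \<otimes> a \<oplus> b = \<zero>} = 1"
proof -
  have a: "inv a \<in> carrier R" "inv a \<otimes> a = \<one>" "a \<otimes> inv a = \<one>"
    using assms by (auto simp: field_Units)
  have "c \<otimes> a \<oplus> b = \<zero> \<longleftrightarrow> c = \<ominus> b \<otimes> inv a" if "c \<in> carrier R" for c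
  proof
    assume "c \<otimes> a \<oplus> b = \<zero>"
    then have "c \<otimes> a = \<ominus> b"
      using assms that by (simp add: minus_equality[symmetric] sum_zero_eq_neg)
    then have "c \<otimes> a \<otimes> inv a = \<ominus> b \<otimes> inv a" by simp
    then show "c = \<ominus> b \<otimes> inv a"
      using assms a that by (simp add: m_assoc)
  next
    assume "c = \<ominus> b \<otimes> inv a"
    then show "c \<otimes> a \<oplus> b = \<zero>"
      using assms a by (simp add: m_assoc l_neg)
  qed
  then have "{c \<in> carrier R. c \<otimes> a \<oplus> b = \<zero>} = {\<ominus> b \<otimes> inv a}"
    using assms a by auto
  then show ?thesis by simp
qed

context
  fixes d q :: nat
  assumes fin: "finite (carrier R)" and q: "card (carrier R) = q"
begin

lemma q_pos: "0 < q"
  using fin q by (metis card_gt_0_iff empty_iff zero_closed)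

lemma finite_vec_space: "finite (vec_space R d)"
  unfolding vec_space_def using fin by (intro finite_PiE) auto

lemma card_vec_space: "card (vec_space R d) = q ^ d"
  by (simp add: vec_space_def card_PiE q)

text \<open>Choose \<open>j\<close> with \<open>y j\<close> nonzero. Once the other coordinates of
  \<open>x\<close> are fixed, the equation is affine in the coordinate \<open>j\<close> with
  invertible leading coefficient, so it has exactly one root.\<close>

lemma card_hyperplane:
  assumes y: "y \<in> vec_space R d" "nonzero_vec d y"
  shows "card {x \<in> vec_space R d. dot R d x y = \<zero>} = q ^ (d - 1)"
proof -
  from y obtain j where j: "j \<in> {1..d}" "y j \<noteq> \<zero>" by auto
  let ?I = "{1..d} - {j}"
  have "card {x \<in> vec_space R d. dot R d x y = \<zero>} =
      card {x \<in> insert j ?I \<rightarrow>\<^sub>E carrier R. dot R d x y = \<zero>}"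
    using j by (simp add: vec_space_def insert_absorb)
  also have "\<dots> = (\<Sum>x \<in> ?I \<rightarrow>\<^sub>E carrier R. card {a \<in> carrier R. dot R d (x(j := a)) y = \<zero>})"
    by (intro card_filter_PiE_insert fin) auto
  also have "\<dots> = (\<Sum>x \<in> ?I \<rightarrow>\<^sub>E carrier R. 1)"
  proof (intro sum.cong refl)
    fix x assume x: "x \<in> ?I \<rightarrow>\<^sub>E carrier R"
    define s where "s = (\<Oplus>i\<in>?I. x i \<otimes> y i)"
    have cl: "x i \<otimes> y i \<in> carrier R" if "i \<in> ?I" for i
    proof (rule m_closed)
      show "x i \<in> carrier R" using PiE_mem[OF x that] .
      show "y i \<in> carrier R" using y(1) that by (intro vec_space_closed) auto
    qed
    then have s: "s \<in> carrier R"
      unfolding s_def by (intro finsum_closed) auto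
    have "dot R d (x(j := a)) y = a \<otimes> y j \<oplus> s" if "a \<in> carrier R" for a
    proof -
      have "dot R d (x(j := a)) y = (\<Oplus>i\<in>insert j ?I. (x(j := a)) i \<otimes> y i)"
        unfolding dot_def using j by (simp add: insert_absorb)
      also have "\<dots> = a \<otimes> y j \<oplus> (\<Oplus>i\<in>?I. (x(j := a)) i \<otimes> y i)"
        using cl that vec_space_closed[OF y(1) j(1)] by (subst finsum_insert) auto
      also have "(\<Oplus>i\<in>?I. (x(j := a)) i \<otimes> y i) = s"
        unfolding s_def using cl by (intro finsum_cong') auto
      finally show ?thesis .
    qed
    then have "{a \<in> carrier R. dot R d (x(j := a)) y = \<zero>} = {a \<in> carrier R. a \<otimes> y j \<oplus> s = \<zero>}"
      by auto
    then show "card {a \<in> carrier R. dot R d (x(j := a)) y = \<zero>} = 1"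
      using card_affine_roots[OF vec_space_closed[OF y(1) j(1)] s j(2)] by simp
  qed
  also have "\<dots> = q ^ (d - 1)"
    using j by (simp add: card_PiE q)
  finally show ?thesis .
qed

text \<open>Double counting of the pairs \<open>(x, c)\<close> with \<open>x \<cdot> (c y + z) = 0\<close>: for given \<open>x\<close> there is one
  such \<open>c\<close> if \<open>x \<cdot> y \<noteq> 0\<close>; otherwise there are \<open>q\<close> or none, according to whether \<open>x \<cdot> z = 0\<close>.\<close>

lemma card_hyperplanes_Int:
  assumes y: "y \<in> vec_space R d" "nonzero_vec d y" and z: "z \<in> vec_space R d"
    and indep: "\<And>c. c \<in> carrier R \<Longrightarrow> nonzero_vec d (axpy d c y z)"
  shows "q * card {x \<in> vec_space R d. dot R d x y = \<zero> \<and> dot R d x z = \<zero>} = q ^ (d - 1)"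
proof -
  let ?V = "vec_space R d"
  let ?M = "{x \<in> ?V. dot R d x y = \<zero> \<and> dot R d x z = \<zero>}"
  let ?H = "{x \<in> ?V. dot R d x y = \<zero>}"
  have d: "d \<noteq> 0" using y by auto
  have "q * q ^ (d - 1) = (\<Sum>c \<in> carrier R. card {x \<in> ?V. dot R d x (axpy d c y z) = \<zero>})"
    using y z indep by (simp add: card_hyperplane axpy_closed q)
  also have "\<dots> = (\<Sum>c \<in> carrier R. card {x \<in> ?V. c \<otimes> dot R d x y \<oplus> dot R d x z = \<zero>})"
    using y z by (intro sum.cong refl arg_cong[where f = card]) (auto simp: dot_axpy)
  also have "\<dots> = (\<Sum>x \<in> ?V. card {c \<in> carrier R. c \<otimes> dot R d x y \<oplus> dot R d x z = \<zero>})"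
    by (intro sum_multicount_gen fin finite_vec_space) auto
  also have "\<dots> = (\<Sum>x \<in> ?V. of_bool (dot R d x y \<noteq> \<zero>) + q * of_bool (x \<in> ?M))"
  proof (intro sum.cong refl)
    fix x assume x: "x \<in> ?V"
    then have cl: "dot R d x y \<in> carrier R" "dot R d x z \<in> carrier R"
      using y z by (auto intro: dot_closed)
    show "card {c \<in> carrier R. c \<otimes> dot R d x y \<oplus> dot R d x z = \<zero>} =
        of_bool (dot R d x y \<noteq> \<zero>) + q * of_bool (x \<in> ?M)"
    proof (cases "dot R d x y = \<zero>")
      case True
      then have "{c \<in> carrier R. c \<otimes> dot R d x y \<oplus> dot R d x z = \<zero>} =
          (if dot R d x z = \<zero> then carrier R else {})"
        using cl by auto
      then show ?thesis
        using True x q by simp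
    next
      case False
      then show ?thesis
        using card_affine_roots[OF cl False] by simp
    qed
  qed
  also have "\<dots> = card {x \<in> ?V. dot R d x y \<noteq> \<zero>} + q * card ?M"
    using finite_vec_space
    by (simp add: sum.distrib sum_distrib_left[symmetric] of_bool_def sum.If_cases Int_def)
  also have "card {x \<in> ?V. dot R d x y \<noteq> \<zero>} = q ^ d - q ^ (d - 1)"
  proof -
    have "{x \<in> ?V. dot R d x y \<noteq> \<zero>} = ?V - ?H" by auto
    then have "card {x \<in> ?V. dot R d x y \<noteq> \<zero>} = card ?V - card ?H"
      using finite_vec_space by (simp add: card_Diff_subset)
    then show ?thesis using y by (simp add: card_hyperplane card_vec_space)
  qed
  finally have "q * q ^ (d - 1) = q ^ d - q ^ (d - 1) + q * card ?M" .
  moreover have "q * q ^ (d - 1) = q ^ d" using d by (metis power_eq_if)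
  \<comment> \<open>Subtraction of naturals truncates, so this inequality is required before the
    difference can be cancelled.\<close>
  moreover have "q ^ (d - 1) \<le> q ^ d" using q_pos by (intro power_increasing) auto
  ultimately show ?thesis by linarith
qed

section \<open>Second moments of the orthogonality indicators\<close>

text \<open>The indicator of the hyperplane orthogonal to \<open>y\<close>, centred so that it has
  mean zero over the space when \<open>y\<close> is nonzero.\<close>

definition dev :: "(nat \<Rightarrow> 'a) \<Rightarrow> (nat \<Rightarrow> 'a) \<Rightarrow> real" where
  "dev y x = of_bool (dot R d x y = \<zero>) - 1 / real q"

text \<open>The unnormalised inner product of \<open>dev y\<close> and \<open>dev z\<close> as
  functions on the whole space.\<close>

definition corr :: "(nat \<Rightarrow> 'a) \<Rightarrow> (nat \<Rightarrow> 'a) \<Rightarrow> real" where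
  "corr y z = (\<Sum>x \<in> vec_space R d. dev y x * dev z x)"

lemma corr_eq:
  "corr y z = real (card {x \<in> vec_space R d. dot R d x y = \<zero> \<and> dot R d x z = \<zero>})
     - (real (card {x \<in> vec_space R d. dot R d x y = \<zero>})
        + real (card {x \<in> vec_space R d. dot R d x z = \<zero>})) / real q
     + real q ^ d / (real q)\<^sup>2"
proof -
  let ?V = "vec_space R d"
  have ind: "real (card {x \<in> ?V. P x}) = (\<Sum>x \<in> ?V. of_bool (P x))" for P
    using finite_vec_space by (simp add: of_bool_def sum.If_cases Int_def)
  have "corr y z = (\<Sum>x \<in> ?V. of_bool (dot R d x y = \<zero> \<and> dot R d x z = \<zero>)
      - (of_bool (dot R d x y = \<zero>) + of_bool (dot R d x z = \<zero>)) / real q + 1 / (real q)\<^sup>2)"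
    unfolding corr_def dev_def
    by (intro sum.cong refl) (auto simp: algebra_simps power2_eq_square add_divide_distrib)
  then show ?thesis
    unfolding ind by (simp add: sum.distrib sum_subtractf card_vec_space flip: sum_divide_distrib)
qed

lemma card_hyperplane_real:
  assumes "y \<in> vec_space R d" "nonzero_vec d y"
  shows "real (card {x \<in> vec_space R d. dot R d x y = \<zero>}) = real q ^ d / real q"
proof -
  have "d \<noteq> 0" using assms by auto
  then have "real q ^ d = real q * real q ^ (d - 1)" by (metis power_eq_if)
  then show ?thesis
    using q_pos by (simp add: card_hyperplane[OF assms])
qed

lemma corr_commute: "corr y z = corr z y"
  by (simp add: corr_def mult.commute)

text \<open>For the zero vector \<open>y\<close> the function \<open>dev y\<close> is constant,
  while \<open>dev z\<close> has mean zero.\<close>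

lemma corr_zero:
  assumes "y \<in> vec_space R d" "z \<in> vec_space R d" "\<not> nonzero_vec d y" "nonzero_vec d z"
  shows "corr y z = 0"
proof -
  have "dot R d x y = \<zero>" if "x \<in> vec_space R d" for x
    using that assms by (intro dot_zero_right)
  then have "{x \<in> vec_space R d. dot R d x y = \<zero> \<and> dot R d x z = \<zero>} =
      {x \<in> vec_space R d. dot R d x z = \<zero>}" "{x \<in> vec_space R d. dot R d x y = \<zero>} = vec_space R d"
    by auto
  then show ?thesis
    using q_pos
    by (simp add: corr_eq card_hyperplane_real[OF assms(2,4)] card_vec_space field_simps
        power2_eq_square)
qed

text \<open>The two hyperplanes meet in a proportion \<open>1 / q\<^sup>2\<close> of the space, the
  product of their densities, so the two events are independent in the probabilistic sense.\<close>

lemma corr_indep: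
  assumes "y \<in> vec_space R d" "nonzero_vec d y" "z \<in> vec_space R d"
    "\<And>c. c \<in> carrier R \<Longrightarrow> nonzero_vec d (axpy d c y z)"
  shows "corr y z = 0"
proof -
  \<comment> \<open>The coefficient zero turns the independence hypothesis into the statement that
    \<open>z\<close> is nonzero.\<close>
  have "nonzero_vec d (axpy d \<zero> y z)" by (intro assms) simp
  then have nz: "nonzero_vec d z"
    using assms vec_space_closed[OF assms(1)] vec_space_closed[OF assms(3)]
    by (auto simp: axpy_def)
  have "real q * real (card {x \<in> vec_space R d. dot R d x y = \<zero> \<and> dot R d x z = \<zero>})
      = real (card {x \<in> vec_space R d. dot R d x y = \<zero>})"
    using card_hyperplanes_Int[OF assms] card_hyperplane[OF assms(1,2)]
    by (simp flip: of_nat_mult)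
  then have "real (card {x \<in> vec_space R d. dot R d x y = \<zero> \<and> dot R d x z = \<zero>})
      = real q ^ d / (real q)\<^sup>2"
    using q_pos unfolding card_hyperplane_real[OF assms(1,2)]
    by (simp add: field_simps power2_eq_square)
  then show ?thesis
    unfolding corr_eq card_hyperplane_real[OF assms(1,2)] card_hyperplane_real[OF assms(3) nz]
    using q_pos by (simp add: field_simps power2_eq_square)
qed

text \<open>The exact value is \<open>q ^ d / q - q ^ d / q\<^sup>2\<close>.\<close>

lemma corr_self_le:
  assumes "y \<in> vec_space R d" "nonzero_vec d y"
  shows "corr y y \<le> real q ^ d / real q"
  unfolding corr_eq using q_pos
  by (simp add: card_hyperplane_real[OF assms] field_simps power2_eq_square)

text \<open>For nonzero \<open>z\<close>, the inequality between arithmetic and geometric means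
  reduces this to the self-correlations.\<close>

lemma corr_le:
  assumes "y \<in> vec_space R d" "z \<in> vec_space R d" "nonzero_vec d y"
  shows "corr y z \<le> real q ^ d / real q"
proof (cases "nonzero_vec d z")
  case True
  have "corr y z \<le> (\<Sum>x \<in> vec_space R d. ((dev y x)\<^sup>2 + (dev z x)\<^sup>2) / 2)"
    unfolding corr_def
  proof (intro sum_mono)
    fix x
    show "dev y x * dev z x \<le> ((dev y x)\<^sup>2 + (dev z x)\<^sup>2) / 2"
      using sum_squares_bound[of "dev y x" "dev z x"] by simp
  qed
  also have "\<dots> = (corr y y + corr z z) / 2"
    by (simp add: corr_def power2_eq_square sum.distrib flip: sum_divide_distrib)
  also have "\<dots> \<le> real q ^ d / real q"
    using add_mono[OF corr_self_le[OF assms(1,3)] corr_self_le[OF assms(2) True]]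
    by (simp add: mult.commute)
  finally show ?thesis .
next
  case False
  then show ?thesis
    using corr_zero[OF assms(2,1) False assms(3)] q_pos by (simp add: corr_commute[of y])
qed

text \<open>For nonzero \<open>y\<close>, only the at most \<open>q\<close> scalar multiples of
  \<open>y\<close> contribute, each at most \<open>q ^ d / q\<close>. For \<open>y\<close> zero,
  only \<open>z = y\<close> contributes, and the trivial bound 1 on each summand of
  \<open>corr y y\<close> suffices.\<close>

lemma sum_corr_le:
  assumes B: "B \<subseteq> vec_space R d" and y: "y \<in> vec_space R d"
  shows "(\<Sum>z\<in>B. corr y z) \<le> real q ^ d"
proof (cases "nonzero_vec d y")
  case True
  define L where "L = {z \<in> B. \<exists>c \<in> carrier R. \<not> nonzero_vec d (axpy d c y z)}"
  have "finite B" using B finite_vec_space finite_subset by blast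
  have "L \<subseteq> (\<lambda>c. \<lambda>i\<in>{1..d}. \<ominus> (c \<otimes> y i)) ` carrier R"
  proof
    fix z assume "z \<in> L"
    then obtain c where c: "c \<in> carrier R" "\<not> nonzero_vec d (axpy d c y z)" and z: "z \<in> vec_space R d"
      using B by (auto simp: L_def)
    have "z i = \<ominus> (c \<otimes> y i)" if "i \<in> {1..d}" for i
    proof -
      have "c \<otimes> y i \<oplus> z i = \<zero>" using c that by (auto simp: axpy_def)
      then show ?thesis
        using c vec_space_closed[OF y that] vec_space_closed[OF z that]
        by (metis a_comm m_closed minus_equality)
    qed
    then have "z = (\<lambda>i\<in>{1..d}. \<ominus> (c \<otimes> y i))"
      using z by (auto simp: vec_space_def intro!: PiE_ext)
    then show "z \<in> (\<lambda>c. \<lambda>i\<in>{1..d}. \<ominus> (c \<otimes> y i)) ` carrier R"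
      using c by auto
  qed
  then have cL: "card L \<le> q"
    using surj_card_le[OF fin] q by blast
  have "(\<Sum>z\<in>B. corr y z) = (\<Sum>z\<in>L. corr y z)"
    using \<open>finite B\<close> B True y by (intro sum.mono_neutral_right) (auto simp: L_def intro!: corr_indep)
  also have "\<dots> \<le> real (card L) * (real q ^ d / real q)"
    using B y True by (intro sum_bounded_above corr_le) (auto simp: L_def)
  also have "\<dots> \<le> real q * (real q ^ d / real q)"
    using cL by (intro mult_right_mono) auto
  also have "\<dots> = real q ^ d" using q_pos by simp
  finally show ?thesis .
next
  case False
  have "finite B" using B finite_vec_space finite_subset by blast
  \<comment> \<open>Vectors are extensional, so there is only one with all coordinates zero.\<close>
  have uniq: "z = y" if "z \<in> vec_space R d" "\<not> nonzero_vec d z" for z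
    using that y False unfolding vec_space_def by (intro PiE_ext[of z _ _ y]) auto
  have "corr y z = 0" if "z \<in> B - {y}" for z
  proof (rule corr_zero[OF y _ False])
    show "z \<in> vec_space R d" using that B by blast
    then show "nonzero_vec d z" using uniq that by blast
  qed
  then have "(\<Sum>z\<in>B. corr y z) = (\<Sum>z\<in>B \<inter> {y}. corr y z)"
    using \<open>finite B\<close> by (intro sum.mono_neutral_right) auto
  also have "\<dots> \<le> \<bar>corr y y\<bar>"
    by (cases "y \<in> B") auto
  also have "\<dots> \<le> (\<Sum>x \<in> vec_space R d. 1)"
    unfolding corr_def
  proof (intro order_trans[OF sum_abs] sum_mono)
    fix x
    have "\<bar>dev y x\<bar> \<le> 1" using q_pos by (auto simp: dev_def field_simps)
    then show "\<bar>dev y x * dev y x\<bar> \<le> 1" by (simp add: abs_square_le_1 flip: power2_eq_square)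
  qed
  also have "\<dots> = real q ^ d" by (simp add: card_vec_space)
  finally show ?thesis .
qed

text \<open>The discrepancy is the sum over \<open>A\<close> of \<open>S x\<close>, the total
  deviation of \<open>B\<close> at \<open>x\<close>. Cauchy--Schwarz against the constant 1 leaves
  the second moment of \<open>S\<close>, which is a sum of correlations over
  \<open>B \<times> B\<close> and is bounded row by row.\<close>

lemma mixing_dot: "mixing (\<lambda>x y. dot R d x y = \<zero>) (vec_space R d) (1 / real q) (sqrt (real q ^ d))"
  unfolding mixing_def
proof (intro allI impI, elim conjE)
  fix A B assume AB: "A \<subseteq> vec_space R d" "B \<subseteq> vec_space R d"
  then have fAB: "finite A" "finite B"
    using finite_vec_space finite_subset by blast+
  define S where "S x = (\<Sum>y\<in>B. dev y x)" for x
  have "card {(a, b) \<in> A \<times> B. dot R d a b = \<zero>} = (\<Sum>a\<in>A. \<Sum>b\<in>B. of_bool (dot R d a b = \<zero>))"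
    using fAB by (subst card_filter_Times, simp, simp, subst sum.swap)
      (simp add: of_bool_def sum.If_cases Int_def)
  then have "real (card {(a, b) \<in> A \<times> B. dot R d a b = \<zero>}) - 1 / real q * real (card A) * real (card B)
      = (\<Sum>a\<in>A. S a)"
    by (simp add: S_def dev_def sum_subtractf)
  moreover have "\<bar>\<Sum>a\<in>A. S a\<bar> \<le> sqrt (real q ^ d) * sqrt (real (card A) * real (card B))"
  proof -
    have "\<bar>\<Sum>a\<in>A. S a\<bar> \<le> (\<Sum>a\<in>A. sqrt (1 * (S a)\<^sup>2))"
      using sum_abs[of S A] by simp
    also have "\<dots> \<le> sqrt ((\<Sum>a\<in>A. 1) * (\<Sum>a\<in>A. (S a)\<^sup>2))"
      by (intro sum_sqrt_mult_le) auto
    \<comment> \<open>Squares are nonnegative, so the sum may be extended from \<open>A\<close> to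
      the whole space, where the correlations are known.\<close>
    also have "\<dots> \<le> sqrt (real (card A) * (\<Sum>x\<in>vec_space R d. (S x)\<^sup>2))"
      using AB finite_vec_space
      by (intro real_sqrt_le_mono) (auto intro!: mult_left_mono sum_mono2)
    also have "(\<Sum>x\<in>vec_space R d. (S x)\<^sup>2) = (\<Sum>x\<in>vec_space R d. \<Sum>y\<in>B. \<Sum>z\<in>B. dev y x * dev z x)"
      by (simp add: S_def power2_eq_square sum_product)
    also have "\<dots> = (\<Sum>y\<in>B. \<Sum>z\<in>B. corr y z)"
      unfolding corr_def
      by (rule trans[OF sum.swap], rule sum.cong[OF refl], rule sum.swap)
    also have "sqrt (real (card A) * \<dots>) \<le> sqrt (real (card A) * (real (card B) * real q ^ d))"
      using AB by (intro real_sqrt_le_mono mult_left_mono sum_bounded_above sum_corr_le) auto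
    also have "\<dots> = sqrt (real q ^ d) * sqrt (real (card A) * real (card B))"
      by (simp add: real_sqrt_mult)
    finally show ?thesis .
  qed
  ultimately show "\<bar>real (card {(a, b) \<in> A \<times> B. dot R d a b = \<zero>})
      - 1 / real q * real (card A) * real (card B)\<bar>
      \<le> sqrt (real q ^ d) * sqrt (real (card A) * real (card B))" by simp
qed

end

end

section \<open>The complete graph on \<open>k\<close> vertices, and the comparison of
  exponents\<close>

lemma card_increasing_pairs: "card {(i, j). 1 \<le> i \<and> i < j \<and> j \<le> (k :: nat)} = k choose 2"
proof (induction k)
  case 0
  have "{(i, j). 1 \<le> i \<and> i < j \<and> j \<le> (0 :: nat)} = {}" by auto
  then show ?case by (simp only: card.empty) simp
next
  case (Suc k)
  let ?P = "{(i, j). 1 \<le> i \<and> i < j \<and> j \<le> k}"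
  have "{(i, j). 1 \<le> i \<and> i < j \<and> j \<le> Suc k} = ?P \<union> {1..k} \<times> {Suc k}"
    by auto
  moreover have "finite ?P"
    by (rule finite_subset[of _ "{..k} \<times> {..k}"]) auto
  moreover have "?P \<inter> {1..k} \<times> {Suc k} = {}" by auto
  ultimately have "card {(i, j). 1 \<le> i \<and> i < j \<and> j \<le> Suc k} = card ?P + k"
    by (simp add: card_Un_disjoint)
  then show ?case
    unfolding Suc.IH by (simp add: numeral_2_eq_2)
qed

lemma mixing_subset: "mixing r V p c \<Longrightarrow> E \<subseteq> V \<Longrightarrow> mixing r E p c"
  unfolding mixing_def by (meson order_trans)

text \<open>The graph is complete on \<open>{1..k}\<close>, with \<open>p = 1 / q\<close> and
  \<open>c = sqrt (q ^ d)\<close>. The hypothesis \<open>large\<close> is the bound on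
  \<open>c\<close> required by \<open>card_homs_approx\<close>, multiplied by
  \<open>q ^ (k - 1)\<close>.\<close>

lemma orth_count_approx:
  fixes R :: "('a, 'b) ring_scheme"
  assumes R: "field R" "finite (carrier R)" "card (carrier R) = q"
    and E: "E \<subseteq> vec_space R d" and k: "1 \<le> k"
    and \<eta>: "0 \<le> \<eta>" "2 * real (k choose 2) * \<eta> \<le> 1"
    and large: "real q powr (real d / 2 + real k - 1) \<le> \<eta> * real (card E)"
  shows "\<bar>real (orth_count R d k E) - (1 / real q) ^ (k choose 2) * real (card E) ^ k\<bar>
    \<le> 2 * real (k choose 2) * \<eta> * ((1 / real q) ^ (k choose 2) * real (card E) ^ k)"
proof -
  interpret field R by fact
  let ?F = "{(i, j). 1 \<le> i \<and> i < j \<and> j \<le> k}"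
  let ?r = "\<lambda>x y. dot R d x y = \<zero>\<^bsub>R\<^esub>"
  have q: "0 < q" using R by (intro q_pos)
  have finE: "finite E"
    using finite_vec_space[OF R(2,3)] E finite_subset by blast
  have mix: "mixing ?r E (1 / real q) (sqrt (real q ^ d))"
    by (rule mixing_subset[OF mixing_dot[OF R(2,3)] E])
  have "sqrt (real q ^ d) * real q ^ (k - 1) = real q powr (real d / 2 + real k - 1)"
  proof -
    have "real q powr (real d / 2 + real k - 1) = real q powr (real d / 2) * real q powr real (k - 1)"
      using k by (simp add: of_nat_diff flip: powr_add add_diff_eq)
    also have "real q powr (real d / 2) = (real q ^ d) powr (1 / 2)"
      using q by (simp add: powr_powr flip: powr_realpow)
    finally show ?thesis
      using q by (simp add: powr_half_sqrt powr_realpow)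
  qed
  then have c: "sqrt (real q ^ d) \<le> \<eta> * real (card E) * (1 / real q) ^ (k - 1)"
    using large q by (simp add: power_divide pos_le_divide_eq)
  have "orth_tuples R d k E = homs ?r E {1..k} ?F"
    by (auto simp: orth_tuples_def homs_def)
  then have count: "orth_count R d k E = card (homs ?r E {1..k} ?F)"
    by (simp add: orth_count_def)
  have "2 * real (card ?F) * \<eta> \<le> 1"
    unfolding card_increasing_pairs by fact
  then have "\<bar>real (card (homs ?r E {1..k} ?F)) - (1 / real q) ^ card ?F * real (card E) ^ card {1..k}\<bar>
    \<le> 2 * real (card ?F) * \<eta> * ((1 / real q) ^ card ?F * real (card E) ^ card {1..k})"
    using q \<eta> c
    by (intro card_homs_approx[OF mix _ finE]) auto
  then show ?thesis
    unfolding count card_increasing_pairs by simp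
qed

text \<open>In the first alternative the required size exceeds that of the whole space, so no
  \<open>E\<close> qualifies. In the second, the 1 in \<open>min 1 \<epsilon>\<close> meets the
  smallness condition of \<open>orth_count_approx\<close> and \<open>\<epsilon>\<close> bounds the
  resulting error.\<close>

lemma eventually_within_if:
  assumes k: "1 \<le> k" and "0 < C" and "0 < \<epsilon>"
    and ev: "\<forall>\<^sub>F q in sequentially. real q ^ d < C * real q powr size_exponent d k \<or>
      2 * real (k choose 2) * (real q powr (real d / 2 + real k - 1 - size_exponent d k) / C)
        \<le> min 1 \<epsilon>"
  shows "eventually_within d k C \<epsilon>"
  unfolding eventually_within_def
  using ev eventually_gt_at_top[of 0]
proof eventually_elim
  case (elim q)
  show ?case
  proof (intro allI impI, elim conjE)
    fix R :: "nat ring" and E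
    assume R: "field R" "finite (carrier R)" "card (carrier R) = q"
      and E: "E \<subseteq> vec_space R d" and large: "C * real q powr size_exponent d k \<le> real (card E)"
    let ?K = "k choose 2"
    \<comment> \<open>The ratio of \<open>q powr (d / 2 + k - 1)\<close> to the smallest size
      allowed for \<open>E\<close>.\<close>
    define \<eta> where "\<eta> = real q powr (real d / 2 + real k - 1 - size_exponent d k) / C"
    have "card E \<le> q ^ d"
      using card_mono[OF field.finite_vec_space[OF R] E] field.card_vec_space[OF R] by simp
    then have "real (card E) \<le> real q ^ d"
      by (metis of_nat_le_iff of_nat_power)
    then have "\<not> real q ^ d < C * real q powr size_exponent d k"
      using large by linarith
    then have \<eta>: "2 * real ?K * \<eta> \<le> min 1 \<epsilon>"
      using elim unfolding \<eta>_def by blast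
    have "0 \<le> \<eta>" using \<open>0 < C\<close> by (simp add: \<eta>_def)
    have "real q powr (real d / 2 + real k - 1) = \<eta> * (C * real q powr size_exponent d k)"
      using \<open>0 < C\<close> by (simp add: \<eta>_def flip: powr_add)
    also have "\<dots> \<le> \<eta> * real (card E)"
      using large \<open>0 \<le> \<eta>\<close> by (rule mult_left_mono)
    finally have bound: "\<bar>real (orth_count R d k E) - (1 / real q) ^ ?K * real (card E) ^ k\<bar>
        \<le> 2 * real ?K * \<eta> * ((1 / real q) ^ ?K * real (card E) ^ k)"
      using \<eta> by (intro orth_count_approx[OF R E k \<open>0 \<le> \<eta>\<close>]) auto
    define N where "N = (1 / real q) ^ ?K * real (card E) ^ k"
    \<comment> \<open>This makes \<open>E\<close> nonempty, so that \<open>N\<close> is positive and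
      can be divided by.\<close>
    have "0 < C * real q powr size_exponent d k"
      using \<open>0 < C\<close> elim by simp
    then have "0 < N"
      using large elim unfolding N_def by (intro mult_pos_pos zero_less_power) auto
    define \<delta> where "\<delta> = real (orth_count R d k E) / N - 1"
    have "\<delta> = (real (orth_count R d k E) - N) / N"
      using \<open>0 < N\<close> by (simp add: \<delta>_def diff_divide_distrib)
    then have "\<bar>\<delta>\<bar> = \<bar>real (orth_count R d k E) - N\<bar> / N"
      using \<open>0 < N\<close> by simp
    also have "\<dots> \<le> 2 * real ?K * \<eta>"
      using bound \<open>0 < N\<close> by (simp add: N_def[symmetric] pos_divide_le_eq)
    also have "\<dots> \<le> \<epsilon>" using \<eta> by simp
    finally have "\<bar>\<delta>\<bar> \<le> \<epsilon>" .
    moreover have "real (orth_count R d k E) = (1 + \<delta>) * N"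
      using \<open>0 < N\<close> by (simp add: \<delta>_def)
    moreover have "N = real (card E) ^ k * real q powr (- real ?K)"
      using elim by (simp add: N_def powr_minus_divide powr_realpow power_one_over)
    ultimately show "\<exists>\<delta>. \<bar>\<delta>\<bar> \<le> \<epsilon> \<and> real (orth_count R d k E) =
        (1 + \<delta>) * real (card E) ^ k * real q powr (- real ?K)"
      by (intro exI[of _ \<delta>]) (simp add: mult.assoc)
  qed
qed

text \<open>The first alternative serves \<open>k = 3\<close>, \<open>d = 4\<close>, where the two
  compared exponents are both 4. In all other cases the strict inequality follows from
  \<open>k choose 2 < d\<close>.\<close>

lemma size_exponent_cases:
  assumes k: "k \<ge> 3" and d: "k choose 2 < d"
  shows "size_exponent d k = real d \<or> real d / 2 + real k - 1 < size_exponent d k"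
proof -
  have "2 * (k choose 2) = k * (k - 1)"
    using binomial_absorption[of 1 k] by (simp add: numeral_2_eq_2)
  from arg_cong[OF this, of real]
  have "real k * (real k - 1) + 2 = 2 * real (k choose 2) + 2"
    using k by simp
  also have "\<dots> \<le> 2 * real d" using d by simp
  finally have kd: "real k * (real k - 1) + 2 \<le> 2 * real d" .
  have gap: "4 * real k * (size_exponent d k - (real d / 2 + real k - 1))
      = 2 * real d * (real k - 2) - 2 * real k * (real k - 1) + 4"
    using k by (simp add: size_exponent_def field_simps)
  have "3 < d" if "k = 3"
    using d that by (simp add: choose_two)
  then consider "k = 3" "d = 4" | "k = 3" "5 \<le> d" | "4 \<le> k"
    using k by linarith
  then show ?thesis
  proof cases
    case 1
    then show ?thesis by (simp add: size_exponent_def)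
  next
    case 2
    then show ?thesis by (simp add: size_exponent_def field_simps)
  next
    case 3
    \<comment> \<open>Inserting the lower bound \<open>kd\<close> for \<open>2 * d\<close> into
      \<open>gap\<close> leaves \<open>k * (k - 1) * (k - 4) + 2 * k\<close>, which is positive from
      \<open>k = 4\<close> on.\<close>
    have "(real k * (real k - 1) + 2) * (real k - 2) \<le> 2 * real d * (real k - 2)"
      using kd 3 by (intro mult_right_mono) auto
    moreover have "(real k * (real k - 1) + 2) * (real k - 2) - 2 * real k * (real k - 1) + 4 =
        real k * (real k - 1) * (real k - 4) + 2 * real k"
      by (simp add: algebra_simps)
    moreover have "0 \<le> real k * (real k - 1) * (real k - 4)"
      using 3 by simp
    ultimately have "0 < 4 * real k * (size_exponent d k - (real d / 2 + real k - 1))"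
      unfolding gap using 3 by linarith
    then show ?thesis
      using 3 by (simp add: zero_less_mult_iff)
  qed
qed

theorem theorem1p1:
  fixes d k :: nat
  assumes "d \<ge> 1" and "k \<ge> 2" and "0 < k choose 2" and "k choose 2 < d"
  shows "(k \<noteq> 2 \<longrightarrow> (\<exists>C>0. \<forall>\<epsilon>>0. eventually_within d k C \<epsilon>)) \<and>
         (k = 2 \<longrightarrow> (\<forall>\<epsilon>>0. \<exists>C>0. eventually_within d k C \<epsilon>))"
proof (intro conjI impI)
  assume "k \<noteq> 2"
  then have k: "k \<ge> 3" using assms by simp
  \<comment> \<open>A constant above 1 is chosen so that a required size of \<open>C * q ^ d\<close>
    cannot be attained; when the exponent \<open>?g\<close> is negative, the error tends to
    0.\<close>
  have "eventually_within d k 2 \<epsilon>" if "\<epsilon> > 0" for \<epsilon>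
  proof (rule eventually_within_if)
    let ?g = "real d / 2 + real k - 1 - size_exponent d k"
    show "\<forall>\<^sub>F q in sequentially. real q ^ d < 2 * real q powr size_exponent d k \<or>
        2 * real (k choose 2) * (real q powr ?g / 2) \<le> min 1 \<epsilon>"
      using size_exponent_cases[OF k assms(4)]
    proof
      assume "size_exponent d k = real d"
      then show ?thesis
        by (intro eventually_mono[OF eventually_gt_at_top[of 0]] disjI1) (simp add: powr_realpow)
    next
      assume "real d / 2 + real k - 1 < size_exponent d k"
      then have "(\<lambda>q. real q powr ?g) \<longlonglongrightarrow> 0"
        by (intro tendsto_neg_powr filterlim_real_sequentially) auto
      then have "(\<lambda>q. 2 * real (k choose 2) * (real q powr ?g / 2)) \<longlonglongrightarrow> 2 * real (k choose 2) * (0 / 2)"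
        by (intro tendsto_intros) auto
      then have "\<forall>\<^sub>F q in sequentially. 2 * real (k choose 2) * (real q powr ?g / 2) < min 1 \<epsilon>"
        using that by (intro order_tendstoD(2)) auto
      then show ?thesis by (auto elim!: eventually_mono)
    qed
  qed (use k that in auto)
  then show "\<exists>C>0. \<forall>\<epsilon>>0. eventually_within d k C \<epsilon>"
    by (intro exI[of _ 2]) auto
next
  assume k: "k = 2"
  show "\<forall>\<epsilon>>0. \<exists>C>0. eventually_within d k C \<epsilon>"
  proof (intro allI impI)
    fix \<epsilon> :: real assume "\<epsilon> > 0"
    have g: "real d / 2 + real k - 1 - size_exponent d k = 0"
      by (simp add: k size_exponent_def field_simps)
    \<comment> \<open>With exponent 0 and a single edge the error bound is \<open>2 / C\<close>,
      constant in \<open>q\<close>; this \<open>C\<close> makes it equal to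
      \<open>min 1 \<epsilon>\<close>.\<close>
    have "eventually_within d k (2 / min 1 \<epsilon>) \<epsilon>"
    proof (rule eventually_within_if)
      show "\<forall>\<^sub>F q in sequentially. real q ^ d < 2 / min 1 \<epsilon> * real q powr size_exponent d k \<or>
          2 * real (k choose 2) *
            (real q powr (real d / 2 + real k - 1 - size_exponent d k) / (2 / min 1 \<epsilon>)) \<le> min 1 \<epsilon>"
        unfolding g using eventually_gt_at_top[of "0 :: nat"]
        by eventually_elim (simp add: k)
    qed (use k \<open>\<epsilon> > 0\<close> in auto)
    then show "\<exists>C>0. eventually_within d k C \<epsilon>"
      using \<open>\<epsilon> > 0\<close> by (intro exI[of _ "2 / min 1 \<epsilon>"]) auto
  qed
qed

end
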